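(* Let $A,B\in\widehat{\mathbb F_q^\times}$ with $B\neq\varepsilon$, $B^2\overline A\neq\varepsilon$ and $A\overline B\phi\neq\varepsilon$. Then for all $z\in\mathbb F_q$ with $z\neq\pm1$, $${}_2\mathbb F_1\!\left[\begin{matrix}A&B\\&B^2\end{matrix};\frac{4z}{(1+z)^2}\right]=A^2(1+z)\,{}_2\mathbb F_1\!\left[\begin{matrix}A&A\phi\overline B\\&B\phi\end{matrix};z^2\right].$$
   Context: $\mathbb F_q$ is a finite field with $q$ elements, $q$ a power of an odd prime $p$. $\widehat{\mathbb F_q^\times}$ is the group of multiplicative characters $\chi:\mathbb F_q^\times\to\mathbb C^\times$; every character, including the trivial character $\varepsilon$, is extended to $\mathbb F_q$ by $\chi(0)=0$. $\phi$ is the quadratic character, $\overline\chi$ denotes the complex-conjugate (inverse) character, and products/powers of characters are pointwise. Jacobi sum: $J(A,B)=\sum_{x\in\mathbb F_q}A(x)B(1-x)$. Period function: ${}_2\mathbb P_1\!\left[\begin{matrix}A&B\\&C\end{matrix};\lambda\right]=\sum_{y\in\mathbb F_q}B(y)\,\overline BC(1-y)\,\overline A(1-\lambda y)$; normalized function ${}_2\mathbb F_1\!\left[\begin{matrix}A&B\\&C\end{matrix};\lambda\right]=\frac{1}{J(B,C\overline B)}\,{}_2\mathbb P_1\!\left[\begin{matrix}A&B\\&C\end{matrix};\lambda\right]$. *)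

theory Defs
  imports Complex_Main
begin

definition mchar :: "('a::{field,finite} \<Rightarrow> complex) \<Rightarrow> bool" where
  "mchar \<chi> \<longleftrightarrow> \<chi> 0 = 0 \<and> \<chi> 1 = 1 \<and> (\<forall>x y. \<chi> (x * y) = \<chi> x * \<chi> y)"

definition triv_char :: "'a::{field,finite} \<Rightarrow> complex" where
  "triv_char x = (if x = 0 then 0 else 1)"

definition quad_char :: "'a::{field,finite} \<Rightarrow> complex" where
  "quad_char x = (if x = 0 then 0 else if (\<exists>y. y ^ 2 = x) then 1 else -1)"

definition cmul :: "('a \<Rightarrow> complex) \<Rightarrow> ('a \<Rightarrow> complex) \<Rightarrow> 'a \<Rightarrow> complex" where
  "cmul A B = (\<lambda>x. A x * B x)"

definition cconj :: "('a \<Rightarrow> complex) \<Rightarrow> 'a \<Rightarrow> complex" where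
  "cconj A = (\<lambda>x. cnj (A x))"

definition cpow :: "('a \<Rightarrow> complex) \<Rightarrow> nat \<Rightarrow> 'a \<Rightarrow> complex" where
  "cpow A n = (\<lambda>x. A x ^ n)"

definition jacobi :: "('a::{field,finite} \<Rightarrow> complex) \<Rightarrow> ('a \<Rightarrow> complex) \<Rightarrow> complex" where
  "jacobi A B = (\<Sum>x\<in>UNIV. A x * B (1 - x))"

definition P21 :: "('a::{field,finite} \<Rightarrow> complex) \<Rightarrow> ('a \<Rightarrow> complex) \<Rightarrow> ('a \<Rightarrow> complex) \<Rightarrow> 'a \<Rightarrow> complex" where
  "P21 A B C l = (\<Sum>y\<in>UNIV. B y * cmul (cconj B) C (1 - y) * cconj A (1 - l * y))"

definition F21 :: "('a::{field,finite} \<Rightarrow> complex) \<Rightarrow> ('a \<Rightarrow> complex) \<Rightarrow> ('a \<Rightarrow> complex) \<Rightarrow> 'a \<Rightarrow> complex" where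
  "F21 A B C l = P21 A B C l / jacobi B (cmul C (cconj B))"

end

theory Submission
  imports Defs "HOL-Number_Theory.Residues"
begin

text \<open>
  Put \<open>w = z\<^sup>2\<close>. Substituting \<open>y = (1 - t)/2\<close>, the period sum on the left becomes, up to
  \<open>A\<^sup>2(1 + z)\<close>, the sum of \<open>B((1 - t\<^sup>2)/4)\<close> times the conjugate of \<open>A(1 + 2zt + w)\<close>, which is
  modelled on the generating function of the Gegenbauer polynomials. Multiply each side by the
  Jacobi sum normalising the other one. Both products are double sums of a quadratic character
  against \<open>B(b)\<close> and the conjugate of \<open>A(a)\<close>; for fixed \<open>(a, b)\<close> the summation variable runs over the
  roots of a quadratic polynomial. The two root sums agree because the discriminant of one
  quadratic is, up to squares, the product of the values of the other sum's argument at its two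
  roots. The degenerate contributions are multiples of the full sums of \<open>B\<close> and of the conjugate of
  \<open>A\<close> times \<open>B\<^sup>2\<close>, which vanish by assumption. The Jacobi sums are nonzero since
  \<open>|J(A, B)|\<^sup>2 = q - \<Sum>\<^sub>x A(x)B(x)\<close>.
\<close>

section \<open>Elementary properties of multiplicative characters\<close>

lemma mchar_zero: "mchar \<chi> \<Longrightarrow> \<chi> 0 = 0"
  and mchar_one: "mchar \<chi> \<Longrightarrow> \<chi> 1 = 1"
  and mchar_mult: "mchar \<chi> \<Longrightarrow> \<chi> (x * y) = \<chi> x * \<chi> y"
  by (auto simp: mchar_def)

lemma mchar_power: "mchar \<chi> \<Longrightarrow> \<chi> (x ^ n) = \<chi> x ^ n"
  by (induction n) (auto simp: mchar_mult mchar_one)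

lemma mchar_mult_inverse: "mchar \<chi> \<Longrightarrow> x \<noteq> 0 \<Longrightarrow> \<chi> x * \<chi> (inverse x) = 1"
  by (metis mchar_mult mchar_one right_inverse)

lemma mchar_eq_0_iff: "mchar \<chi> \<Longrightarrow> \<chi> x = 0 \<longleftrightarrow> x = 0"
  by (metis mchar_mult_inverse mchar_zero mult_zero_left zero_neq_one)

lemma mchar_inverse: "mchar \<chi> \<Longrightarrow> \<chi> (inverse x) = inverse (\<chi> x)"
  by (metis inverse_unique inverse_zero mchar_mult_inverse mchar_zero)

lemma mchar_divide: "mchar \<chi> \<Longrightarrow> \<chi> (x / y) = \<chi> x / \<chi> y"
  by (simp add: divide_inverse mchar_mult mchar_inverse)

lemmas mchar_basics = mchar_zero mchar_one mchar_eq_0_iff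

text \<open>The powers of \<open>x\<close> repeat because the field is finite, so two different
  powers of the positive real \<open>norm (\<chi> x)\<close> agree, which forces it to be 1.\<close>

lemma norm_mchar:
  fixes x :: "'a::{field,finite}"
  assumes "mchar \<chi>" "x \<noteq> 0"
  shows "norm (\<chi> x) = 1"
proof -
  have "\<not> inj (\<lambda>n::nat. x ^ n)"
    using finite_imageD[of "\<lambda>n::nat. x ^ n" UNIV] by auto
  then obtain i j :: nat where ij: "x ^ i = x ^ j" "i \<noteq> j"
    by (auto simp: inj_def)
  define r where "r = norm (\<chi> x)"
  have r: "r > 0" using assms by (simp add: r_def mchar_eq_0_iff)
  have "r ^ i = r ^ j"
    using ij(1) assms by (metis mchar_power norm_power r_def)
  then show ?thesis
    using r ij(2) power_inject_exp'[of r i j] unfolding r_def by blast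
qed

text \<open>Since \<open>inverse 0 = 0\<close>, the identity covers \<open>x = 0\<close> too, and
  conjugates can be replaced by inverses without a case distinction.\<close>

lemma cconj_mchar:
  assumes "mchar \<chi>"
  shows "cconj \<chi> x = inverse (\<chi> x)"
proof (cases "x = 0")
  case False
  then have "\<chi> x * cnj (\<chi> x) = 1"
    using norm_mchar[OF assms] by (simp add: complex_norm_square[symmetric])
  then show ?thesis by (metis cconj_def inverse_unique)
qed (use assms in \<open>simp add: cconj_def mchar_zero\<close>)

lemma mchar_cmul: "mchar \<chi> \<Longrightarrow> mchar \<psi> \<Longrightarrow> mchar (cmul \<chi> \<psi>)"
  by (simp add: mchar_def cmul_def mult_ac)

lemma mchar_cconj: "mchar \<chi> \<Longrightarrow> mchar (cconj \<chi>)"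
  by (simp add: mchar_def cconj_def)

lemma mchar_cpow: "mchar \<chi> \<Longrightarrow> n > 0 \<Longrightarrow> mchar (cpow \<chi> n)"
  by (simp add: mchar_def cpow_def power_mult_distrib)

section \<open>Complete character sums and the absolute value of Jacobi sums\<close>

text \<open>Multiplication by a nonzero \<open>a\<close> with \<open>\<chi> a \<noteq> 1\<close>
  permutes the field and multiplies the sum by \<open>\<chi> a\<close>.\<close>

lemma sum_mchar_eq_0:
  fixes \<chi> :: "'a::{field,finite} \<Rightarrow> complex"
  assumes "mchar \<chi>" "\<chi> \<noteq> triv_char"
  shows "(\<Sum>x\<in>UNIV. \<chi> x) = 0"
proof -
  obtain a where "\<chi> a \<noteq> triv_char a" using assms(2) by auto
  then have a: "a \<noteq> 0" "\<chi> a \<noteq> 1"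
    using mchar_zero[OF assms(1)] by (auto simp: triv_char_def split: if_splits)
  have "(\<Sum>x\<in>UNIV. \<chi> x) = (\<Sum>x\<in>UNIV. \<chi> (a * x))"
    by (rule sum.reindex_bij_witness[of _ "\<lambda>x. a * x" "\<lambda>x. x / a"]) (use a in auto)
  also have "\<dots> = \<chi> a * (\<Sum>x\<in>UNIV. \<chi> x)"
    by (simp add: mchar_mult[OF assms(1)] sum_distrib_left)
  finally show ?thesis using a by simp
qed

lemma norm_sum_mchar_le:
  fixes \<chi> :: "'a::{field,finite} \<Rightarrow> complex"
  assumes "mchar \<chi>"
  shows "norm (\<Sum>x\<in>UNIV. \<chi> x) \<le> real (card (UNIV :: 'a set)) - 1"
proof -
  have "(\<Sum>x\<in>UNIV. \<chi> x) = (\<Sum>x\<in>UNIV-{0}. \<chi> x)"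
    by (rule sum.mono_neutral_right) (use mchar_zero[OF assms] in auto)
  also have "norm \<dots> \<le> (\<Sum>x\<in>UNIV-{0::'a}. 1)"
    by (rule sum_norm_le) (use norm_mchar[OF assms] in auto)
  also have "\<dots> = real (card (UNIV :: 'a set)) - 1"
    by (simp add: card_Diff_singleton Suc_leI of_nat_diff finite_UNIV_card_ge_0)
  finally show ?thesis .
qed

text \<open>In the double sum over \<open>x\<close> and \<open>y\<close>, the substitution
  \<open>x = u * y\<close> leaves \<open>A u\<close> times \<open>B\<close> at the Moebius
  expression \<open>(1 - u * y) / (1 - y)\<close>. For \<open>u \<noteq> 1\<close> this is injective
  in \<open>y\<close>, so the sum over \<open>y\<close> is a full sum of \<open>B\<close> up to two
  missing values; only \<open>u = 1\<close> gives a term of size about q.\<close>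

lemma jacobi_norm_sq:
  fixes A B :: "'a::{field,finite} \<Rightarrow> complex"
  assumes A: "mchar A" "A \<noteq> triv_char" and B: "mchar B" "B \<noteq> triv_char"
  shows "jacobi A B * cnj (jacobi A B)
       = of_nat (card (UNIV :: 'a set)) - (\<Sum>x\<in>UNIV. A x * B x)"
proof -
  note AB = mchar_basics[OF A(1)] mchar_basics[OF B(1)]
  note mu = mchar_mult[OF A(1)] mchar_mult[OF B(1)] mchar_inverse[OF A(1)]
    mchar_inverse[OF B(1)] mchar_divide[OF A(1)] mchar_divide[OF B(1)]
  have cA: "cnj (A x) = inverse (A x)" and cB: "cnj (B x) = inverse (B x)" for x
    using cconj_mchar[OF A(1)] cconj_mchar[OF B(1)] by (auto simp: cconj_def)
  \<comment> \<open>The Moebius map sends 0, 1 and infinity to 1, infinity and \<open>u\<close>. It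
    therefore maps \<open>-{0,1}\<close> onto \<open>-{1,u}\<close>, and the two values missing from
    the full sum account for \<open>- B u - 1\<close>.\<close>
  have inner: "(\<Sum>y\<in>-{0,1}. B ((1 - u * y) / (1 - y))) = - B u - 1"
    if u: "u \<noteq> 1" for u
  proof -
    have diff_y: "1 - (1 - u * y) / (1 - y) = y * (u - 1) / (1 - y)"
      "u - (1 - u * y) / (1 - y) = (u - 1) / (1 - y)" if "y \<noteq> 1" for y
      using that by (simp_all add: field_simps)
    have y: "(1 - (1 - u * y) / (1 - y)) / (u - (1 - u * y) / (1 - y)) = y"
      "(1 - u * y) / (1 - y) \<in> -{1,u}" if "y \<in> -{0,1}" for y
    proof -
      have y1: "y \<noteq> 0" "y \<noteq> 1" using that by auto
      show "(1 - (1 - u * y) / (1 - y)) / (u - (1 - u * y) / (1 - y)) = y"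
        unfolding diff_y[OF y1(2)] using y1 u by simp
      have "1 - (1 - u * y) / (1 - y) \<noteq> 0" "u - (1 - u * y) / (1 - y) \<noteq> 0"
        unfolding diff_y[OF y1(2)] using y1 u by simp_all
      then show "(1 - u * y) / (1 - y) \<in> -{1,u}" by (metis ComplI eq_iff_diff_eq_0 insertE singletonD)
    qed
    have diff_v: "1 - u * ((1 - v) / (u - v)) = v * (u - 1) / (u - v)"
      "1 - (1 - v) / (u - v) = (u - 1) / (u - v)" if "v \<noteq> u" for v
      using that by (simp_all add: field_simps)
    have v: "(1 - u * ((1 - v) / (u - v))) / (1 - (1 - v) / (u - v)) = v"
      "(1 - v) / (u - v) \<in> -{0,1}" if "v \<in> -{1,u}" for v
    proof -
      have v1: "v \<noteq> 1" "v \<noteq> u" using that by auto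
      show "(1 - u * ((1 - v) / (u - v))) / (1 - (1 - v) / (u - v)) = v"
        unfolding diff_v[OF v1(2)] using v1 u by simp
      have "1 - (1 - v) / (u - v) \<noteq> 0" "(1 - v) / (u - v) \<noteq> 0"
        unfolding diff_v[OF v1(2)] using v1 u by simp_all
      then show "(1 - v) / (u - v) \<in> -{0,1}" by (metis ComplI eq_iff_diff_eq_0 insertE singletonD)
    qed
    have "(\<Sum>y\<in>-{0,1}. B ((1 - u * y) / (1 - y))) = (\<Sum>v\<in>-{1,u}. B v)"
      by (rule sum.reindex_bij_witness[of _ "\<lambda>v. (1 - v) / (u - v)"
            "\<lambda>y. (1 - u * y) / (1 - y)"]) (rule y v refl, assumption?)+
    also have "\<dots> = (\<Sum>v\<in>UNIV. B v) - (\<Sum>v\<in>{1,u}. B v)"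
      using sum_diff[of UNIV "{1,u}" B] by (simp add: Compl_eq_Diff_UNIV)
    finally show ?thesis
      using u sum_mchar_eq_0[OF B] by (auto simp: AB)
  qed
  have inner1: "(\<Sum>y\<in>-{0,1::'a}. B ((1 - 1 * y) / (1 - y))) = of_nat (card (UNIV :: 'a set)) - 2"
  proof -
    have "(\<Sum>y\<in>-{0,1::'a}. B ((1 - 1 * y) / (1 - y))) = (\<Sum>y\<in>-{0,1::'a}. 1)"
      by (rule sum.cong) (auto simp: AB)
    also have "\<dots> = (\<Sum>y\<in>(UNIV::'a set). 1) - (\<Sum>y\<in>{0,1::'a}. 1)"
      using sum_diff[of UNIV "{0,1}" "\<lambda>_::'a. 1::complex"] by (simp add: Compl_eq_Diff_UNIV)
    finally show ?thesis by simp
  qed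
  have "jacobi A B * cnj (jacobi A B)
      = (\<Sum>y\<in>UNIV. \<Sum>x\<in>UNIV. A x * B (1 - x) * (inverse (A y) * inverse (B (1 - y))))"
    unfolding jacobi_def cnj_sum sum_distrib_left sum_distrib_right by (simp add: cA cB)
  \<comment> \<open>The terms at \<open>y = 0\<close> and \<open>y = 1\<close> vanish because
    \<open>inverse 0 = 0\<close>.\<close>
  also have "\<dots> = (\<Sum>y\<in>-{0,1}. \<Sum>x\<in>UNIV. A x * B (1 - x) * (inverse (A y) * inverse (B (1 - y))))"
    by (rule sum.mono_neutral_right) (auto simp: AB)
  also have "\<dots> = (\<Sum>y\<in>-{0,1}. \<Sum>u\<in>UNIV. A u * B ((1 - u * y) / (1 - y)))"
  proof (rule sum.cong[OF refl])
    fix y :: 'a assume y: "y \<in> -{0,1}"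
    show "(\<Sum>x\<in>UNIV. A x * B (1 - x) * (inverse (A y) * inverse (B (1 - y))))
        = (\<Sum>u\<in>UNIV. A u * B ((1 - u * y) / (1 - y)))"
      by (rule sum.reindex_bij_witness[of _ "\<lambda>u. u * y" "\<lambda>x. x / y"])
         (use y in \<open>auto simp: mu AB field_simps\<close>)
  qed
  also have "\<dots> = (\<Sum>u\<in>UNIV. A u * (\<Sum>y\<in>-{0,1}. B ((1 - u * y) / (1 - y))))"
    by (subst sum.swap) (simp add: sum_distrib_left)
  also have "\<dots> = (of_nat (card (UNIV :: 'a set)) - 2) + (\<Sum>u\<in>UNIV-{1}. A u * (- B u - 1))"
    using inner inner1 by (subst sum.remove[of _ 1]) (auto simp: AB)
  \<comment> \<open>The 2 compensates for the removed term \<open>A 1 * (- B 1 - 1)\<close>, which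
    is -2.\<close>
  also have "(\<Sum>u\<in>UNIV-{1}. A u * (- B u - 1)) = (\<Sum>u\<in>UNIV. A u * (- B u - 1)) + 2"
    by (simp add: sum_diff1 AB)
  also have "(\<Sum>u\<in>UNIV. A u * (- B u - 1)) = - (\<Sum>u\<in>UNIV. A u * B u) - (\<Sum>u\<in>UNIV. A u)"
    by (simp add: algebra_simps sum.distrib sum_subtractf sum_negf)
  finally show ?thesis using sum_mchar_eq_0[OF A] by simp
qed

text \<open>A vanishing Jacobi sum would make the sum of \<open>cmul A B\<close> equal to q, above
  the bound q - 1 for any character sum.\<close>

lemma jacobi_nonzero:
  fixes A B :: "'a::{field,finite} \<Rightarrow> complex"
  assumes A: "mchar A" "A \<noteq> triv_char" and B: "mchar B" "B \<noteq> triv_char"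
  shows "jacobi A B \<noteq> 0"
proof
  assume "jacobi A B = 0"
  then have "(\<Sum>x\<in>UNIV. cmul A B x) = of_nat (card (UNIV :: 'a set))"
    using jacobi_norm_sq[OF assms] by (simp add: cmul_def)
  then have "norm (\<Sum>x\<in>UNIV. cmul A B x) = real (card (UNIV :: 'a set))"
    by simp
  then show False
    using norm_sum_mchar_le[OF mchar_cmul[OF A(1) B(1)]] by simp
qed

section \<open>Odd characteristic and the quadratic character\<close>

lemma two_neq_zero_of_odd_card:
  assumes "odd (card (UNIV :: 'a::{field,finite} set))"
  shows "(2::'a) \<noteq> 0"
proof
  assume two: "(2::'a) = 0"
  have "CHAR('a) dvd 2"
    using two of_nat_eq_0_iff_char_dvd[where 'a = 'a, of 2] by (metis of_nat_numeral)
  then have "CHAR('a) = 1 \<or> CHAR('a) = 2"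
    by (metis prime_nat_iff two_is_prime_nat)
  then show False
    using assms CHAR_dvd_CARD[where 'a = 'a] CHAR_not_1'[where 'a = 'a] by auto
qed

lemma quad_char_0 [simp]: "quad_char 0 = 0"
  by (simp add: quad_char_def)

lemma quad_char_sq: "x \<noteq> 0 \<Longrightarrow> quad_char (x ^ 2) = 1"
  by (auto simp: quad_char_def)

text \<open>The common inner sum of both products. The roots are the solutions of
  \<open>(1 - y) * (1 - w * y) = a * y\<close>, and at a root the argument of
  \<open>quad_char\<close> equals \<open>((1 - y) ^ 2 - 4 * b * y) / y\<close>.\<close>

definition quad_sum :: "'a::{field,finite} \<Rightarrow> 'a \<Rightarrow> 'a \<Rightarrow> complex" where
  "quad_sum w a b = (\<Sum>y | w * y ^ 2 - (a + 1 + w) * y + 1 = 0.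
     quad_char (a + 1 + w - (2 + 4 * b) + (1 - w) * y))"

context
  assumes two: "(2::'a::{field,finite}) \<noteq> 0"
begin

lemma neg_neq: "x \<noteq> 0 \<Longrightarrow> - x \<noteq> (x::'a)"
  using two by (metis add.right_inverse mult_2 mult_eq_0_iff)

lemma four_neq_zero: "(4::'a) \<noteq> 0"
  using two by (metis mult_2 mult_eq_0_iff numeral_Bit0)

lemma card_sqrt: "complex_of_nat (card {u::'a. u ^ 2 = w}) = 1 + quad_char w"
proof (cases "\<exists>y. y ^ 2 = w")
  case True
  then obtain y where y: "w = y ^ 2" by blast
  then have "{u. u ^ 2 = w} = {y, - y}" by (auto simp: power2_eq_iff)
  then show ?thesis
    using neg_neq[of y] by (cases "y = 0") (auto simp: y quad_char_def card_insert_if)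
next
  case False
  then have "{u. u ^ 2 = w} = {}" by auto
  moreover have "w \<noteq> 0" using False by (metis zero_power2)
  ultimately show ?thesis using False by (auto simp: quad_char_def)
qed

text \<open>Squaring is two-to-one on nonzero elements, so nonzero squares and nonsquares are
  equally many. Multiplication by \<open>g\<close> injects the former into the latter, hence is
  onto, and \<open>h\<close> is \<open>g\<close> times a square.\<close>

lemma mult_nonsquares:
  fixes g h :: 'a
  assumes g: "\<nexists>y. y ^ 2 = g" and h: "\<nexists>y. y ^ 2 = h"
  shows "\<exists>y. y ^ 2 = g * h"
proof -
  define S where "S = (\<lambda>y::'a. y ^ 2) ` (-{0})"
  define N where "N = -{0::'a} - S"
  have g0: "g \<noteq> 0" and h0: "h \<noteq> 0" using g h by (metis zero_power2)+
  have fib: "card {y \<in> -{0::'a}. y ^ 2 = s} = 2" if "s \<in> S" for s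
  proof -
    from that obtain y where y: "y \<noteq> 0" "s = y ^ 2" by (auto simp: S_def)
    then have "{y \<in> -{0::'a}. y ^ 2 = s} = {y, - y}" by (auto simp: power2_eq_iff)
    then show ?thesis using neg_neq[of y] y by (auto simp: card_insert_if)
  qed
  have "card (-{0::'a}) = (\<Sum>s\<in>S. card {y \<in> -{0::'a}. y ^ 2 = s})"
    using sum.group[of "-{0::'a}" S "\<lambda>y. y ^ 2" "\<lambda>_. 1::nat"] by (simp add: S_def)
  then have "card (-{0::'a}) = 2 * card S" using fib by simp
  moreover have "S \<subseteq> -{0}" by (auto simp: S_def)
  ultimately have cards: "card N = card S"
    by (simp add: N_def card_Diff_subset)
  have sub: "(*) g ` S \<subseteq> N"
  proof
    fix v assume "v \<in> (*) g ` S"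
    then obtain y where y: "y \<noteq> 0" "v = g * y ^ 2" by (auto simp: S_def)
    have "v \<notin> S"
    proof
      assume "v \<in> S"
      then obtain t where "g * y ^ 2 = t ^ 2" using y by (auto simp: S_def)
      then have "(t / y) ^ 2 = g" using y by (simp add: power_divide field_simps)
      then show False using g by blast
    qed
    then show "v \<in> N" using y g0 by (auto simp: N_def)
  qed
  have "card ((*) g ` S) = card N"
    using cards g0 by (subst card_image) (auto simp: inj_on_def)
  with sub have "(*) g ` S = N" by (intro card_subset_eq) auto
  moreover have "h \<in> N" using h h0 by (auto simp: N_def S_def)
  ultimately obtain y where "h = g * y ^ 2" by (auto simp: S_def)
  then have "(g * y) ^ 2 = g * h" by (simp add: power2_eq_square)
  then show ?thesis by blast
qed

lemma mchar_quad_char: "mchar (quad_char :: 'a \<Rightarrow> complex)"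
proof -
  have sqmul: "(\<exists>y. y ^ 2 = x * v ^ 2) \<longleftrightarrow> (\<exists>y. y ^ 2 = x)" if "v \<noteq> 0" for x v :: 'a
  proof
    assume "\<exists>y. y ^ 2 = x * v ^ 2"
    then obtain y where "y ^ 2 = x * v ^ 2" by blast
    then have "(y / v) ^ 2 = x" using that by (simp add: power_divide)
    then show "\<exists>y. y ^ 2 = x" by blast
  next
    assume "\<exists>y. y ^ 2 = x"
    then show "\<exists>y. y ^ 2 = x * v ^ 2" by (metis power_mult_distrib)
  qed
  have "quad_char (x * y) = quad_char x * quad_char y" for x y :: 'a
  proof (cases "x = 0 \<or> y = 0")
    case False
    consider v where "y = v ^ 2" | v where "x = v ^ 2"
      | "\<nexists>v. v ^ 2 = x" "\<nexists>v. v ^ 2 = y" by metis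
    then show ?thesis
    proof cases
      case 1
      with False sqmul[of v x] show ?thesis by (auto simp: quad_char_def)
    next
      case 2
      with False sqmul[of v y] show ?thesis by (auto simp: quad_char_def mult.commute)
    next
      case 3
      with False mult_nonsquares show ?thesis by (auto simp: quad_char_def)
    qed
  qed auto
  then show ?thesis
    unfolding mchar_def by (auto simp: quad_char_def) (metis one_power2)
qed

section \<open>Quadratic character sums over the roots of quadratics\<close>

lemma quadratic_iff_square:
  fixes a b c x :: 'a
  assumes "a \<noteq> 0"
  shows "a * x ^ 2 - 2 * b * x + c = 0 \<longleftrightarrow> (a * x - b) ^ 2 = b ^ 2 - a * c"
proof -
  have "(a * x - b) ^ 2 - (b ^ 2 - a * c) = a * (a * x ^ 2 - 2 * b * x + c)"
    by (simp add: power2_eq_square algebra_simps)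
  then have "(a * x - b) ^ 2 - (b ^ 2 - a * c) = 0 \<longleftrightarrow> a * x ^ 2 - 2 * b * x + c = 0"
    using assms by simp
  then show ?thesis by simp
qed

lemma quad_char_mult_sq:
  fixes x v :: 'a
  assumes "v \<noteq> 0"
  shows "quad_char (x * v ^ 2) = quad_char x"
  using assms by (simp add: mchar_mult[OF mchar_quad_char] quad_char_sq)

lemma quad_char_divide_sq:
  fixes x v :: 'a
  assumes "v \<noteq> 0"
  shows "quad_char (x / v ^ 2) = quad_char x"
  using assms by (simp add: mchar_divide[OF mchar_quad_char] quad_char_sq)

text \<open>\<open>D\<close> is the discriminant of the \<open>y\<close>-quadratic, and that of the
  \<open>x\<close>-quadratic is a square times the product of the values of
  \<open>m - n + (1 - w) * y\<close> at the two roots \<open>y\<close>. If either discriminant is a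
  nonsquare, one side has no roots and the characters on the other side cancel. Otherwise the terms
  are matched directly.\<close>

lemma sum_quad_char_roots:
  fixes m n w z :: 'a
  assumes w: "w = z ^ 2" "w \<noteq> 0" "w \<noteq> 1"
  defines "D \<equiv> m ^ 2 - 4 * w" and "Q \<equiv> (1 + w) * m - 2 * w * n"
  shows "(\<Sum>x | D * x ^ 2 - 2 * Q * x + (1 - w) ^ 2 = 0. quad_char x)
       = (\<Sum>y | w * y ^ 2 - m * y + 1 = 0. quad_char (m - n + (1 - w) * y))"
    (is "sum _ ?X = sum _ ?Y")
proof -
  have z: "z \<noteq> 0" using w by auto
  have c: "1 - w \<noteq> 0" using w by auto
  note four = four_neq_zero
  have Y: "y \<in> ?Y \<longleftrightarrow> (2 * w * y - m) ^ 2 = D" for y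
  proof -
    have "(2 * w * y - m) ^ 2 - D = 4 * w * (w * y ^ 2 - m * y + 1)"
      unfolding D_def by (simp add: power2_eq_square algebra_simps)
    then have "(2 * w * y - m) ^ 2 - D = 0 \<longleftrightarrow> w * y ^ 2 - m * y + 1 = 0"
      using four w(2) by simp
    then show ?thesis by simp
  qed
  show ?thesis
  proof (cases "\<exists>d. d ^ 2 = D")
    \<comment> \<open>There is no root \<open>y\<close>; the product \<open>(1 - w) ^ 2 / D\<close>
      of two roots \<open>x\<close> is a nonsquare, so their characters are opposite.\<close>
    case False
    then have D0: "D \<noteq> 0" by (metis zero_power2)
    have Ye: "?Y = {}" using False Y by blast
    have "sum quad_char ?X = 0"
    proof (cases "?X = {}")
      case False
      then obtain x where x: "D * x ^ 2 - 2 * Q * x + (1 - w) ^ 2 = 0" by blast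
      have x0: "x \<noteq> 0" using x c by auto
      define x' where "x' = (1 - w) ^ 2 / (D * x)"
      have xx': "D * x * x' = (1 - w) ^ 2" using D0 x0 by (simp add: x'_def)
      have sumx: "D * (x + x') = 2 * Q"
      proof -
        have "x * (D * (x + x') - 2 * Q)
            = (D * x ^ 2 - 2 * Q * x + (1 - w) ^ 2) + (D * x * x' - (1 - w) ^ 2)"
          by (simp add: power2_eq_square algebra_simps)
        then have "x * (D * (x + x') - 2 * Q) = 0" using x xx' by simp
        then show ?thesis using x0 by simp
      qed
      have fact: "D * u ^ 2 - 2 * Q * u + (1 - w) ^ 2 = D * (u - x) * (u - x')" for u
      proof -
        have "D * (u - x) * (u - x') = D * u ^ 2 - u * (D * (x + x')) + D * x * x'"
          by (simp add: power2_eq_square algebra_simps)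
        then show ?thesis unfolding sumx xx' by (simp add: mult_ac)
      qed
      have X: "?X = {x, x'}" unfolding fact using D0 by auto
      have "x \<noteq> x'"
      proof
        assume "x = x'"
        then have "((1 - w) / x) ^ 2 = D"
          using xx' x0 by (simp add: power2_eq_square field_simps)
        then show False using \<open>\<nexists>d. d ^ 2 = D\<close> by blast
      qed
      moreover have "quad_char x' = - quad_char x"
      proof -
        have "quad_char x' = quad_char (D * x * (((1 - w) / (D * x)) ^ 2))"
          using D0 x0 by (simp add: x'_def power2_eq_square)
        also have "\<dots> = quad_char D * quad_char x"
          using D0 x0 c by (subst quad_char_mult_sq) (auto simp: mchar_mult[OF mchar_quad_char])
        also have "quad_char D = -1" using D0 \<open>\<nexists>d. d ^ 2 = D\<close> by (simp add: quad_char_def)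
        finally show ?thesis by simp
      qed
      ultimately show ?thesis unfolding X by simp
    qed simp
    then show ?thesis unfolding Ye by simp
  next
    case True
    then obtain d0 where d0: "d0 ^ 2 = D" by blast
    \<comment> \<open>The roots \<open>y\<close> are indexed by a square root \<open>d\<close> of
      \<open>D\<close>, so that its sign can be chosen later to make \<open>p d\<close>
      nonzero.\<close>
    define y where "y d = (m + d) / (2 * w)" for d
    define p where "p d = m - n + (1 - w) * y d" for d
    have y: "2 * w * y d = m + d" for d using two w(2) by (simp add: y_def)
    have Yd: "?Y = {y d, y (- d)}" if "d ^ 2 = D" for d
    proof -
      have "v \<in> ?Y \<longleftrightarrow> v = y d \<or> v = y (- d)" for v
      proof -
        have "v \<in> ?Y \<longleftrightarrow> 2 * w * v - m = d \<or> 2 * w * v - m = - d"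
          unfolding Y using that by (metis power2_eq_iff)
        also have "\<dots> \<longleftrightarrow> 2 * w * v = m + d \<or> 2 * w * v = m + - d"
          by (metis add.commute diff_add_cancel add_diff_cancel_left')
        also have "\<dots> \<longleftrightarrow> v = y d \<or> v = y (- d)"
          using two w(2) unfolding y[symmetric] by simp
        finally show ?thesis .
      qed
      then show ?thesis by blast
    qed
    have ysum: "w * (y d + y (- d)) = m" for d
    proof -
      have "2 * (w * (y d + y (- d))) = 2 * w * y d + 2 * w * y (- d)"
        by (simp add: algebra_simps)
      also have "\<dots> = 2 * m" unfolding y by simp
      finally have "2 * (w * (y d + y (- d))) = 2 * m" .
      then show ?thesis using two by simp
    qed
    have Qp: "Q = w * (p d + p (- d))" for d
    proof -
      have "w * (p d + p (- d)) = 2 * w * (m - n) + (1 - w) * (w * (y d + y (- d)))"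
        by (simp add: p_def algebra_simps)
      then show ?thesis unfolding ysum Q_def by (simp add: algebra_simps)
    qed
    have yprod: "w * (y d * y (- d)) = 1" if "d ^ 2 = D" for d
    proof -
      have "4 * w * (w * (y d * y (- d))) = (2 * w * y d) * (2 * w * y (- d))"
        by simp
      also have "\<dots> = m ^ 2 - d ^ 2" unfolding y by (simp add: power2_eq_square algebra_simps)
      also have "\<dots> = 4 * w * 1" unfolding that D_def by simp
      finally have "4 * w * (w * (y d * y (- d))) = 4 * w * 1" .
      then show ?thesis using four w(2) mult_left_cancel[of "4 * w"] by simp
    qed
    \<comment> \<open>The left side is a quarter of the discriminant of the
      \<open>x\<close>-quadratic; the right side follows from the sum and product of the roots
      \<open>y\<close>.\<close>
    have disc: "Q ^ 2 - D * (1 - w) ^ 2 = 4 * w ^ 2 * (p d * p (- d))" if "d ^ 2 = D" for d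
    proof -
      have "4 * w ^ 2 * (p d * p (- d)) = 4 * w * (w * (m - n) ^ 2
          + (m - n) * (1 - w) * (w * (y d + y (- d))) + (1 - w) ^ 2 * (w * (y d * y (- d))))"
        by (simp add: p_def power2_eq_square algebra_simps)
      then show ?thesis
        unfolding ysum yprod[OF that] Q_def D_def by (simp add: power2_eq_square algebra_simps)
    qed
    show ?thesis
    proof (cases "D = 0")
      \<comment> \<open>Here \<open>y 0\<close> is a double root, and the \<open>x\<close>-quadratic
        degenerates to a linear equation, or to a nonzero constant if
        \<open>p 0 = 0\<close>.\<close>
      case True
      with d0 have "d0 = 0" by simp
      have Y0: "?Y = {y 0}" using Yd[OF d0] \<open>d0 = 0\<close> by simp
      have Q0: "Q = 2 * w * p 0" using Qp[of 0] by simp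
      show ?thesis
      proof (cases "p 0 = 0")
        case True
        then have "?X = {}" using Q0 \<open>D = 0\<close> c by auto
        then show ?thesis unfolding Y0 using True by (simp add: p_def)
      next
        case False
        have "?X = {p 0 * ((1 - w) / (2 * z * p 0)) ^ 2}"
        proof -
          have "D * x ^ 2 - 2 * Q * x + (1 - w) ^ 2 = 0 \<longleftrightarrow>
              x = p 0 * ((1 - w) / (2 * z * p 0)) ^ 2" for x
          proof -
            have "D * x ^ 2 - 2 * Q * x + (1 - w) ^ 2 = (1 - w) ^ 2 - x * (4 * w * p 0)"
              unfolding \<open>D = 0\<close> Q0 by (simp add: mult_ac)
            then have "D * x ^ 2 - 2 * Q * x + (1 - w) ^ 2 = 0 \<longleftrightarrow> x = (1 - w) ^ 2 / (4 * w * p 0)"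
              using False four w(2) by (auto simp: eq_divide_eq)
            also have "(1 - w) ^ 2 / (4 * w * p 0) = p 0 * ((1 - w) / (2 * z * p 0)) ^ 2"
              using False unfolding w(1) power_divide power_mult_distrib
              by (simp add: power2_eq_square)
            finally show ?thesis .
          qed
          then show ?thesis by blast
        qed
        moreover have "quad_char (p 0 * ((1 - w) / (2 * z * p 0)) ^ 2) = quad_char (p 0)"
          using False two z c by (intro quad_char_mult_sq) auto
        ultimately show ?thesis unfolding Y0 by (simp add: p_def)
      qed
    next
      case False
      \<comment> \<open>If both values vanished, \<open>disc\<close> and \<open>Qp\<close> would
        give \<open>D * (1 - w) ^ 2 = 0\<close>.\<close>
      have "\<not> (p d0 = 0 \<and> p (- d0) = 0)"
        using disc[OF d0] Qp[of d0] False c by auto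
      then obtain d where d: "d ^ 2 = D" "p d \<noteq> 0" using d0 by fastforce
      have dne: "d \<noteq> 0" using d False by auto
      have "y d \<noteq> y (- d)"
      proof
        assume "y d = y (- d)"
        then have "m + d = m + - d" unfolding y[symmetric] by simp
        then show False using neg_neq[OF dne] by simp
      qed
      then have Ysum: "(\<Sum>v\<in>?Y. quad_char (m - n + (1 - w) * v)) = quad_char (p d) + quad_char (p (- d))"
        unfolding Yd[OF d(1)] by (simp add: p_def)
      have X: "x \<in> ?X \<longleftrightarrow> (D * x - Q) ^ 2 = 4 * w ^ 2 * (p d * p (- d))" for x
        using quadratic_iff_square[OF False, of x Q "(1 - w) ^ 2"] disc[OF d(1)] by simp
      show ?thesis
      proof (cases "\<exists>s. s ^ 2 = p d * p (- d)")
        case False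
        have "?X = {}"
        proof (rule equals0I)
          fix x assume "x \<in> ?X"
          then have "((D * x - Q) / (2 * w)) ^ 2 = p d * p (- d)"
            using four w(2) unfolding X by (simp add: power_divide power_mult_distrib)
          then show False using False by blast
        qed
        moreover have "quad_char (p d) + quad_char (p (- d)) = 0"
        proof -
          have "p (- d) \<noteq> 0" using False by (metis mult_zero_right zero_power2)
          then have "quad_char (p d) * quad_char (p (- d)) = -1"
            using False d(2) by (simp add: mchar_mult[OF mchar_quad_char, symmetric])
              (simp add: quad_char_def)
          then show ?thesis
            unfolding quad_char_def by (auto split: if_splits)
        qed
        ultimately show ?thesis unfolding Ysum by simp
      next
        case True
        then obtain s where s: "s ^ 2 = p d * p (- d)" by blast
        define r where "r = s / p d"
        have r: "p (- d) = p d * r ^ 2"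
          using s d(2) by (simp add: r_def power2_eq_square field_simps)
        \<comment> \<open>By \<open>Qp\<close> and \<open>disc\<close> the roots satisfy
          \<open>D * x = w * p d * (1 + e) ^ 2\<close> with \<open>e = r\<close> or
          \<open>e = - r\<close>. Since \<open>D = d ^ 2\<close> and \<open>w = z ^ 2\<close> are
          squares, both roots are square multiples of \<open>p d\<close>.\<close>
        define x where "x e = p d * ((z * (1 + e)) / d) ^ 2" for e
        have xD: "D * x e = w * p d * (1 + e) ^ 2" for e
          using dne unfolding x_def d(1)[symmetric] w(1) by (simp add: power2_eq_square field_simps)
        have Xe: "?X = {x r, x (- r)}"
        proof -
          have "v \<in> ?X \<longleftrightarrow> v = x r \<or> v = x (- r)" for v
          proof -
            have "v \<in> ?X \<longleftrightarrow> (D * v - Q) ^ 2 = (2 * w * p d * r) ^ 2"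
              unfolding X r by (simp add: power2_eq_square mult_ac)
            also have "\<dots> \<longleftrightarrow> D * v - Q = 2 * w * p d * r \<or> D * v - Q = - (2 * w * p d * r)"
              by (rule power2_eq_iff)
            also have "\<dots> \<longleftrightarrow> D * v = D * x r \<or> D * v = D * x (- r)"
            proof -
              have "D * x r = Q + 2 * w * p d * r" "D * x (- r) = Q - 2 * w * p d * r"
                unfolding xD Qp[of d] r by (simp_all add: power2_eq_square algebra_simps)
              then show ?thesis by (auto simp: algebra_simps)
            qed
            finally show ?thesis using False by simp
          qed
          then show ?thesis by blast
        qed
        have "x r \<in> ?X" "x (- r) \<in> ?X" unfolding Xe by auto
        then have "x r \<noteq> 0" "x (- r) \<noteq> 0" using c by auto
        then have q: "quad_char (x r) = quad_char (p d)" "quad_char (x (- r)) = quad_char (p d)"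
          unfolding x_def by (auto intro!: quad_char_mult_sq)
        show ?thesis
        \<comment> \<open>For \<open>r = 0\<close> the two roots \<open>x\<close> coincide, matching
          \<open>quad_char (p (- d)) = 0\<close>.\<close>
        proof (cases "r = 0")
          case True
          then show ?thesis unfolding Ysum Xe using q r by simp
        next
          case r0: False
          have "D * x r - D * x (- r) = 4 * w * p d * r"
            unfolding xD by (simp add: power2_eq_square algebra_simps)
          then have "x r \<noteq> x (- r)" using four w(2) d(2) r0 by auto
          then show ?thesis
            unfolding Ysum Xe r using q r0 by (simp add: quad_char_mult_sq)
        qed
      qed
    qed
  qed
qed

section \<open>Both products as the same double sum\<close>

text \<open>Completing the square turns \<open>s * (1 - s) = b\<close> into
  \<open>(1 - 2 * s) ^ 2 = 1 - 4 * b\<close>, whose solutions \<open>card_sqrt\<close>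
  counts.\<close>

lemma sum_mult_one_minus:
  fixes f :: "'a \<Rightarrow> complex"
  shows "(\<Sum>s\<in>UNIV. f (s * (1 - s))) = (\<Sum>b\<in>UNIV. f b * (1 + quad_char (1 - 4 * b)))"
proof -
  have card: "of_nat (card {s::'a. s * (1 - s) = b}) = 1 + quad_char (1 - 4 * b)" for b
  proof -
    have "(1 - 2 * s) ^ 2 = 1 - 4 * (s * (1 - s))" for s :: 'a
      by (simp add: power2_eq_square algebra_simps)
    then have "s * (1 - s) = b \<longleftrightarrow> (1 - 2 * s) ^ 2 = 1 - 4 * b" for s :: 'a
      using four_neq_zero by simp
    then have set: "{s. s * (1 - s) = b} = {s. (1 - 2 * s) ^ 2 = 1 - 4 * b}" by blast
    have "bij_betw (\<lambda>s. 1 - 2 * s) {s. s * (1 - s) = b} {u. u ^ 2 = 1 - 4 * b}"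
      unfolding set
      by (rule bij_betw_byWitness[where f' = "\<lambda>u. (1 - u) / 2"])
         (use two in \<open>auto simp: diff_divide_distrib\<close>)
    then show ?thesis
      using card_sqrt[of "1 - 4 * b"] by (metis bij_betw_same_card)
  qed
  have "(\<Sum>s\<in>UNIV. f (s * (1 - s))) = (\<Sum>b\<in>UNIV. \<Sum>s | s * (1 - s) = b. f (s * (1 - s)))"
    using sum.group[of UNIV UNIV "\<lambda>s. s * (1 - s)" "\<lambda>s. f (s * (1 - s))"] by simp
  also have "\<dots> = (\<Sum>b\<in>UNIV. \<Sum>s | s * (1 - s) = b. f b)"
    by (intro sum.cong) auto
  finally show ?thesis by (simp add: card mult.commute)
qed

text \<open>\<open>jacobi B B\<close> is the sum of \<open>B b * quad_char (1 - 4 * b)\<close>,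
  because the full sum of \<open>B\<close> vanishes. Scaling \<open>b\<close> by
  \<open>(1 - y) ^ 2 / y\<close> absorbs the factor in front.\<close>

lemma jacobi_diag_scaled:
  fixes B :: "'a \<Rightarrow> complex" and y :: 'a
  assumes B: "mchar B" "B \<noteq> triv_char" and y: "y \<noteq> 0" "y \<noteq> 1"
  shows "B ((1 - y) ^ 2 / y) * jacobi B B = (\<Sum>b\<in>UNIV. B b * quad_char ((1 - y) ^ 2 - 4 * b * y))"
proof -
  have "jacobi B B = (\<Sum>b\<in>UNIV. B b * (1 + quad_char (1 - 4 * b)))"
    using sum_mult_one_minus[of B] by (simp add: jacobi_def mchar_mult[OF B(1)])
  also have "\<dots> = (\<Sum>b\<in>UNIV. B b * quad_char (1 - 4 * b))"
    using sum_mchar_eq_0[OF B] by (simp add: distrib_left sum.distrib)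
  finally have "B ((1 - y) ^ 2 / y) * jacobi B B
      = (\<Sum>b\<in>UNIV. B ((1 - y) ^ 2 / y) * (B b * quad_char (1 - 4 * b)))"
    by (simp add: sum_distrib_left)
  also have "\<dots> = (\<Sum>b\<in>UNIV. B b * quad_char ((1 - y) ^ 2 - 4 * b * y))"
  proof (rule sum.reindex_bij_witness[of _ "\<lambda>b. b * y / (1 - y) ^ 2" "\<lambda>b. b * (1 - y) ^ 2 / y"])
    fix b :: 'a
    have "(1 - y) ^ 2 - 4 * (b * (1 - y) ^ 2 / y) * y = (1 - 4 * b) * (1 - y) ^ 2"
      using y by (simp add: algebra_simps)
    then show "B (b * (1 - y) ^ 2 / y) * quad_char ((1 - y) ^ 2 - 4 * (b * (1 - y) ^ 2 / y) * y)
        = B ((1 - y) ^ 2 / y) * (B b * quad_char (1 - 4 * b))"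
      using y by (simp add: quad_char_mult_sq mchar_mult[OF B(1)] mchar_divide[OF B(1)])
  qed (use y in auto)
  finally show ?thesis .
qed

text \<open>The first factor is the period sum on the right of the theorem. Its
  \<open>C\<close>-factors combine to \<open>C (al y)\<close>, its \<open>B\<close>-factors are
  expanded over \<open>b\<close> by \<open>jacobi_diag_scaled\<close>, and grouping by
  \<open>a = al y\<close> produces the roots in \<open>quad_sum\<close>.\<close>

lemma period_quad_sum:
  fixes B C :: "'a \<Rightarrow> complex" and w :: 'a
  assumes B: "mchar B" "B \<noteq> triv_char" and C: "mchar C"
  shows "(\<Sum>y\<in>UNIV. quad_char y / (C y * B y) * (B (1 - y) ^ 2 * C (1 - y)) * C (1 - w * y)) * jacobi B B
       = (\<Sum>a\<in>UNIV. C a * (\<Sum>b\<in>UNIV. B b * quad_sum w a b))"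
proof -
  note mu = mchar_mult[OF B(1)] mchar_mult[OF C] mchar_divide[OF B(1)] mchar_divide[OF C]
    mchar_power[OF B(1)] mchar_power[OF C]
  define al where "al y = (1 - y) * (1 - w * y) / y" for y
  define h where "h y = C (al y) * (\<Sum>b\<in>UNIV. B b * quad_char (((1 - y) ^ 2 - 4 * b * y) / y))" for y
  have h: "quad_char y / (C y * B y) * (B (1 - y) ^ 2 * C (1 - y)) * C (1 - w * y) * jacobi B B = h y"
    if y: "y \<noteq> 0" for y
  proof (cases "y = 1")
    \<comment> \<open>\<open>jacobi_diag_scaled\<close> excludes \<open>y = 1\<close>, but there
      both sides vanish since \<open>C 0 = 0\<close>.\<close>
    case True
    then show ?thesis by (simp add: h_def al_def mchar_zero[OF B(1)] mchar_zero[OF C])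
  next
    case False
    have qq: "quad_char y * quad_char v = quad_char (v / y)" for v
    proof -
      have "quad_char (v / y) = quad_char (v * y / y ^ 2)" using y by (simp add: power2_eq_square)
      then show ?thesis
        using y by (simp add: quad_char_divide_sq mchar_mult[OF mchar_quad_char] mult.commute)
    qed
    have "quad_char y / (C y * B y) * (B (1 - y) ^ 2 * C (1 - y)) * C (1 - w * y) * jacobi B B
        = quad_char y * C (al y) * (B ((1 - y) ^ 2 / y) * jacobi B B)"
      by (simp add: al_def mu)
    also have "\<dots> = C (al y) * (\<Sum>b\<in>UNIV. B b * (quad_char y * quad_char ((1 - y) ^ 2 - 4 * b * y)))"
      unfolding jacobi_diag_scaled[OF B y False] by (simp add: sum_distrib_left mult_ac)
    finally show ?thesis by (simp add: h_def qq)
  qed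
  have "(\<Sum>y\<in>UNIV. quad_char y / (C y * B y) * (B (1 - y) ^ 2 * C (1 - y)) * C (1 - w * y)) * jacobi B B
      = (\<Sum>y\<in>UNIV. quad_char y / (C y * B y) * (B (1 - y) ^ 2 * C (1 - y)) * C (1 - w * y) * jacobi B B)"
    by (rule sum_distrib_right)
  also have "\<dots> = (\<Sum>y\<in>-{0}. quad_char y / (C y * B y) * (B (1 - y) ^ 2 * C (1 - y)) * C (1 - w * y) * jacobi B B)"
    by (rule sum.mono_neutral_right) auto
  also have "\<dots> = (\<Sum>y\<in>-{0}. h y)"
    by (rule sum.cong[OF refl]) (rule h, simp)
  also have "\<dots> = (\<Sum>a\<in>UNIV. \<Sum>y\<in>{y\<in>-{0}. al y = a}. h y)"
    using sum.group[of "-{0}" UNIV al h] by simp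
  also have "\<dots> = (\<Sum>a\<in>UNIV. C a * (\<Sum>b\<in>UNIV. B b * quad_sum w a b))"
  proof (rule sum.cong[OF refl])
    fix a :: 'a
    have set: "{y\<in>-{0}. al y = a} = {y. w * y ^ 2 - (a + 1 + w) * y + 1 = 0}" (is "_ = ?Y")
    proof -
      have "y \<noteq> 0 \<and> al y = a \<longleftrightarrow> w * y ^ 2 - (a + 1 + w) * y + 1 = 0" for y
      proof (cases "y = 0")
        case False
        have "w * y ^ 2 - (a + 1 + w) * y + 1 = (1 - y) * (1 - w * y) - a * y"
          by (simp add: power2_eq_square algebra_simps)
        then show ?thesis using False by (simp add: al_def divide_eq_eq)
      qed simp
      then show ?thesis by auto
    qed
    \<comment> \<open>Reducing modulo the quadratic satisfied by \<open>y\<close> makes the argument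
      linear in \<open>y\<close>.\<close>
    have arg: "((1 - y) ^ 2 - 4 * b * y) / y = a + 1 + w - (2 + 4 * b) + (1 - w) * y" if "y \<in> ?Y" for y b
    proof -
      have y0: "y \<noteq> 0" using that by auto
      have "(1 - y) ^ 2 - 4 * b * y = (a + 1 + w - (2 + 4 * b) + (1 - w) * y) * y
          + (w * y ^ 2 - (a + 1 + w) * y + 1)"
        by (simp add: power2_eq_square algebra_simps)
      then show ?thesis using that y0 by (simp add: divide_eq_eq)
    qed
    have "(\<Sum>y\<in>{y\<in>-{0}. al y = a}. h y)
        = (\<Sum>y\<in>{y\<in>-{0}. al y = a}. C a * (\<Sum>b\<in>UNIV. B b * quad_char (((1 - y) ^ 2 - 4 * b * y) / y)))"
      by (rule sum.cong) (auto simp: h_def)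
    also have "\<dots> = (\<Sum>y\<in>?Y. C a * (\<Sum>b\<in>UNIV. B b * quad_char (a + 1 + w - (2 + 4 * b) + (1 - w) * y)))"
      unfolding set by (rule sum.cong[OF refl]) (simp only: arg)
    also have "\<dots> = C a * (\<Sum>b\<in>UNIV. B b * quad_sum w a b)"
      unfolding quad_sum_def sum_distrib_left by (rule sum.swap)
    finally show "(\<Sum>y\<in>{y\<in>-{0}. al y = a}. h y) = C a * (\<Sum>b\<in>UNIV. B b * quad_sum w a b)" .
  qed
  finally show ?thesis .
qed

text \<open>The first factor is the Jacobi sum normalising the right of the theorem. For fixed
  \<open>x\<close>, replacing \<open>t\<close> by
  \<open>a = (1 - x) * (1 + 2 * z * t + z ^ 2) / x\<close> collects the \<open>C\<close>-factors
  into \<open>C a\<close>. Grouping by the argument \<open>b\<close> of \<open>B\<close> leaves the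
  \<open>x\<close>-quadratic of \<open>sum_quad_char_roots\<close> with
  \<open>m = a + 1 + z ^ 2\<close> and \<open>n = 2 + 4 * b\<close>.\<close>

lemma gegenbauer_quad_sum:
  fixes B C :: "'a \<Rightarrow> complex" and z :: 'a
  assumes B: "mchar B" and C: "mchar C" and BC: "cmul (cpow B 2) C \<noteq> triv_char"
    and z: "z \<noteq> 0" "z ^ 2 \<noteq> 1"
  shows "(\<Sum>x\<in>UNIV. quad_char x / (C x * B x) * (B (1 - x) ^ 2 * C (1 - x)))
       * (\<Sum>t\<in>UNIV. B ((1 - t ^ 2) / 4) * C (1 + 2 * z * t + z ^ 2))
       = (\<Sum>a\<in>UNIV. C a * (\<Sum>b\<in>UNIV. B b * quad_sum (z ^ 2) a b))"
proof -
  note mu = mchar_mult[OF B(1)] mchar_mult[OF C] mchar_divide[OF B(1)] mchar_divide[OF C]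
    mchar_power[OF B(1)] mchar_power[OF C]
  define w where "w = z ^ 2"
  have w: "w \<noteq> 0" "w \<noteq> 1" using z by (auto simp: w_def)
  \<comment> \<open>This is \<open>(1 - x) ^ 2 / x * ((1 - t ^ 2) / 4)\<close> with \<open>t\<close>
    expressed through \<open>a\<close>, written so that it stays meaningful at
    \<open>x = 1\<close>.\<close>
  define be where "be a x = ((1 - x) ^ 2 - ((x * a - (1 + w) * (1 - x)) / (2 * z)) ^ 2) / (4 * x)" for a x
  define G where "G x t = quad_char x / (C x * B x) * (B (1 - x) ^ 2 * C (1 - x))
    * (B ((1 - t ^ 2) / 4) * C (1 + 2 * z * t + w))" for x t
  have inner: "(\<Sum>t\<in>UNIV. G x t) = (\<Sum>a\<in>UNIV. quad_char x * (C a * B (be a x)))"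
    if x: "x \<noteq> 0" "x \<noteq> 1" for x
  proof (rule sum.reindex_bij_witness[of _ "\<lambda>a. (a * x / (1 - x) - (1 + w)) / (2 * z)"
        "\<lambda>t. (1 - x) * (1 + 2 * z * t + w) / x"])
    fix t :: 'a
    let ?a = "(1 - x) * (1 + 2 * z * t + w) / x"
    show "(?a * x / (1 - x) - (1 + w)) / (2 * z) = t"
      using x z two by simp
    have "x * ?a - (1 + w) * (1 - x) = (2 * z) * ((1 - x) * t)"
    proof -
      have "x * ?a = (1 - x) * (1 + 2 * z * t + w)" using x by simp
      then show ?thesis by (simp only:) (simp add: algebra_simps)
    qed
    then have "(x * ?a - (1 + w) * (1 - x)) / (2 * z) = (1 - x) * t"
      using z two by simp
    then have "be ?a x = ((1 - x) ^ 2 - ((1 - x) * t) ^ 2) / (4 * x)" by (simp only: be_def)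
    also have "\<dots> = (1 - x) ^ 2 / x * ((1 - t ^ 2) / 4)"
    proof -
      have "(1 - x) ^ 2 - ((1 - x) * t) ^ 2 = (1 - x) ^ 2 * (1 - t ^ 2)"
        unfolding power_mult_distrib by (simp add: right_diff_distrib)
      then show ?thesis by (simp only: times_divide_times_eq mult.commute)
    qed
    finally have be: "be ?a x = (1 - x) ^ 2 / x * ((1 - t ^ 2) / 4)" .
    show "quad_char x * (C ?a * B (be ?a x)) = G x t"
      unfolding be G_def by (simp add: mu mult_ac)
  next
    fix a :: 'a
    show "(1 - x) * (1 + 2 * z * ((a * x / (1 - x) - (1 + w)) / (2 * z)) + w) / x = a"
      using x z two by simp
  qed auto
  \<comment> \<open>No \<open>t\<close> corresponds to \<open>x = 1\<close>, but the root sums below include it; its total contribution vanishes.\<close>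
  have one: "(\<Sum>a\<in>UNIV. quad_char (1::'a) * (C a * B (be a 1))) = 0"
  proof -
    have "quad_char (1::'a) * (C a * B (be a 1)) = B (- 1 / (16 * w)) * cmul (cpow B 2) C a" for a
    proof -
      have "be a 1 = (- 1 / (16 * w)) * a ^ 2"
        by (simp add: be_def w_def power_divide power_mult_distrib)
      then have "B (be a 1) = B (- 1 / (16 * w)) * B a ^ 2" by (simp only: mu)
      then show ?thesis
        by (simp add: cmul_def cpow_def mchar_one[OF mchar_quad_char])
    qed
    then show ?thesis
      using sum_mchar_eq_0[OF mchar_cmul[OF mchar_cpow[OF B] C] BC]
      by (simp add: sum_distrib_left[symmetric])
  qed
  have "(\<Sum>x\<in>UNIV. quad_char x / (C x * B x) * (B (1 - x) ^ 2 * C (1 - x)))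
       * (\<Sum>t\<in>UNIV. B ((1 - t ^ 2) / 4) * C (1 + 2 * z * t + w)) = (\<Sum>x\<in>UNIV. \<Sum>t\<in>UNIV. G x t)"
    by (simp only: sum_product G_def)
  also have "\<dots> = (\<Sum>x\<in>-{0,1}. \<Sum>t\<in>UNIV. G x t)"
    by (rule sum.mono_neutral_right) (auto simp: G_def mchar_zero[OF B])
  also have "\<dots> = (\<Sum>x\<in>-{0,1}. \<Sum>a\<in>UNIV. quad_char x * (C a * B (be a x)))"
    by (rule sum.cong) (auto simp: inner)
  also have "\<dots> = (\<Sum>x\<in>-{0}. \<Sum>a\<in>UNIV. quad_char x * (C a * B (be a x)))"
    by (rule sum.mono_neutral_left) (auto simp: one)
  also have "\<dots> = (\<Sum>a\<in>UNIV. C a * (\<Sum>x\<in>-{0}. B (be a x) * quad_char x))"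
    by (subst sum.swap) (simp add: sum_distrib_left mult_ac)
  also have "\<dots> = (\<Sum>a\<in>UNIV. C a * (\<Sum>b\<in>UNIV. B b * quad_sum w a b))"
  proof (intro sum.cong[OF refl] arg_cong[where f = "(*) (C _)"])
    fix a :: 'a
    have set: "{x\<in>-{0}. be a x = b} = {x. ((a + 1 + w) ^ 2 - 4 * w) * x ^ 2
        - 2 * ((1 + w) * (a + 1 + w) - 2 * w * (2 + 4 * b)) * x + (1 - w) ^ 2 = 0}" (is "_ = {x. ?q x = 0}") for b
    proof -
      have "x \<noteq> 0 \<and> be a x = b \<longleftrightarrow> ?q x = 0" for x
      proof (cases "x = 0")
        case True
        then show ?thesis using w by simp
      next
        case False
        have "?q x = (x * a - (1 + w) * (1 - x)) ^ 2 - 4 * w * ((1 - x) ^ 2 - 4 * x * b)"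
          by (simp add: power2_eq_square algebra_simps)
        moreover have "be a x = b \<longleftrightarrow> (1 - x) ^ 2 - ((x * a - (1 + w) * (1 - x)) / (2 * z)) ^ 2 = b * (4 * x)"
          using False four_neq_zero by (simp add: be_def divide_eq_eq)
        moreover have "((x * a - (1 + w) * (1 - x)) / (2 * z)) ^ 2 = (x * a - (1 + w) * (1 - x)) ^ 2 / (4 * w)"
          by (simp add: power_divide power_mult_distrib w_def)
        moreover have "p - r / (4 * w) = b * (4 * x) \<longleftrightarrow> r - 4 * w * (p - 4 * x * b) = 0" for p r
        proof -
          have "r - 4 * w * (p - 4 * x * b) = - (4 * w) * (p - r / (4 * w) - b * (4 * x))"
            using four_neq_zero w by (simp add: right_diff_distrib mult_ac)
          then show ?thesis using four_neq_zero w by simp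
        qed
        ultimately show ?thesis using False by simp
      qed
      then show ?thesis by auto
    qed
    have "(\<Sum>x\<in>-{0}. B (be a x) * quad_char x)
        = (\<Sum>b\<in>UNIV. \<Sum>x\<in>{x\<in>-{0}. be a x = b}. B (be a x) * quad_char x)"
      using sum.group[of "-{0}" UNIV "be a" "\<lambda>x. B (be a x) * quad_char x"] by simp
    also have "\<dots> = (\<Sum>b\<in>UNIV. B b * (\<Sum>x\<in>{x\<in>-{0}. be a x = b}. quad_char x))"
      by (auto simp: sum_distrib_left intro!: sum.cong)
    also have "\<dots> = (\<Sum>b\<in>UNIV. B b * quad_sum w a b)"
      unfolding set quad_sum_def using sum_quad_char_roots[OF w_def w] by simp
    finally show "(\<Sum>x\<in>-{0}. B (be a x) * quad_char x) = (\<Sum>b\<in>UNIV. B b * quad_sum w a b)" .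
  qed
  finally show ?thesis unfolding w_def .
qed

end

section \<open>From period sums to the normalised functions\<close>

theorem mainTheorem8:
  fixes A B :: "'a::{field,finite} \<Rightarrow> complex" and z :: 'a
  assumes odd_q: "odd (card (UNIV :: 'a set))"
    and A: "mchar A" and B: "mchar B"
    and hB: "B \<noteq> triv_char"
    and hB2A: "cmul (cpow B 2) (cconj A) \<noteq> triv_char"
    and hABphi: "cmul (cmul A (cconj B)) quad_char \<noteq> triv_char"
    and hz1: "z \<noteq> 1" and hz2: "z \<noteq> -1"
  shows "F21 A B (cpow B 2) (4 * z / (1 + z) ^ 2)
       = cpow A 2 (1 + z) * F21 A (cmul (cmul A quad_char) (cconj B)) (cmul B quad_char) (z ^ 2)"
proof -
  have two: "(2::'a) \<noteq> 0" by (rule two_neq_zero_of_odd_card[OF odd_q])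
  note four = four_neq_zero[OF two]
  note Q = mchar_quad_char[OF two]
  define C where "C = cconj A"
  \<comment> \<open>\<open>E\<close> and \<open>F\<close> are the characters evaluated at
    \<open>y\<close> and \<open>1 - y\<close> in the right-hand period sum, so its normalising
    factor is \<open>jacobi E F\<close>.\<close>
  define E where "E = cmul (cmul A quad_char) (cconj B)"
  define F where "F = cmul (cpow B 2) (cconj A)"
  have C: "mchar C" unfolding C_def by (rule mchar_cconj[OF A])
  have E: "mchar E" unfolding E_def by (intro mchar_cmul mchar_cconj A B Q)
  have F: "mchar F" unfolding F_def by (intro mchar_cmul mchar_cconj mchar_cpow A B) simp
  have Ex: "E x = quad_char x / (C x * B x)" for x
    by (simp add: E_def C_def cmul_def cconj_mchar[OF A] cconj_mchar[OF B] field_simps)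
  have Fx: "F x = B x ^ 2 * C x" for x
    by (simp add: F_def C_def cmul_def cpow_def)
  have BB: "cmul (cpow B 2) (cconj B) = B" "cmul (cconj B) (cpow B 2) = B"
    by (auto simp: fun_eq_iff cmul_def cpow_def cconj_mchar[OF B] power2_eq_square field_simps)
  have EF: "cmul (cmul B quad_char) (cconj E) = F" "cmul (cconj E) (cmul B quad_char) = F"
  proof -
    have "cmul (cmul B quad_char) (cconj E) x = F x" for x
      by (cases "x = 0") (auto simp: cmul_def cconj_mchar[OF E] Ex Fx mchar_zero[OF B]
          mchar_eq_0_iff[OF Q] power2_eq_square)
    then show "cmul (cmul B quad_char) (cconj E) = F" by blast
    then show "cmul (cconj E) (cmul B quad_char) = F" by (simp add: cmul_def mult.commute)
  qed
  have J1: "jacobi B B \<noteq> 0" by (rule jacobi_nonzero[OF B hB B hB])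
  have "E \<noteq> triv_char"
    using hABphi by (simp add: E_def cmul_def mult_ac)
  then have J2: "jacobi E F \<noteq> 0"
    using hB2A by (intro jacobi_nonzero E F) (auto simp: F_def)
  have lhs: "F21 A B (cpow B 2) l = P21 A B (cpow B 2) l / jacobi B B"
    and P1: "P21 A B (cpow B 2) l = (\<Sum>y\<in>UNIV. B y * B (1 - y) * C (1 - l * y))" for l
    by (simp_all add: F21_def P21_def BB C_def)
  have rhs: "F21 A E (cmul B quad_char) l = P21 A E (cmul B quad_char) l / jacobi E F"
    and P2: "P21 A E (cmul B quad_char) l = (\<Sum>y\<in>UNIV. E y * F (1 - y) * C (1 - l * y))" for l
    by (simp_all add: F21_def P21_def EF C_def)
  show ?thesis
  proof (cases "z = 0")
    \<comment> \<open>Both normalised functions are 1 at 0; this case is separate because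
      \<open>gegenbauer_quad_sum\<close> solves for \<open>t\<close> by dividing by
      \<open>2 * z\<close>.\<close>
    case True
    have "P21 A B (cpow B 2) 0 = jacobi B B" "P21 A E (cmul B quad_char) 0 = jacobi E F"
      by (simp_all add: P1 P2 jacobi_def mchar_one[OF C])
    then show ?thesis
      unfolding E_def[symmetric] lhs rhs using True J1 J2 by (simp add: cpow_def mchar_one[OF A])
  next
    case False
    have z1: "1 + z \<noteq> 0" using hz2 by (metis add.commute add_eq_0_iff)
    have z2: "z ^ 2 \<noteq> 1" using hz1 hz2 by (simp add: power2_eq_1_iff)
    have AC: "A x * C x = 1" if "x \<noteq> 0" for x
      using that by (simp add: C_def cconj_mchar[OF A] mchar_eq_0_iff[OF A])
    define T where "T = (\<Sum>t\<in>UNIV. B ((1 - t ^ 2) / 4) * C (1 + 2 * z * t + z ^ 2))"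
    have "P21 A B (cpow B 2) (4 * z / (1 + z) ^ 2)
        = (\<Sum>t\<in>UNIV. A (1 + z) ^ 2 * (B ((1 - t ^ 2) / 4) * C (1 + 2 * z * t + z ^ 2)))"
      unfolding P1
    \<comment> \<open>With \<open>y = (1 - t) / 2\<close>, the product \<open>y * (1 - y)\<close> is
      \<open>(1 - t ^ 2) / 4\<close>, and the argument of \<open>C\<close> is
      \<open>(1 + 2 * z * t + z ^ 2) / (1 + z) ^ 2\<close>, whose denominator yields
      \<open>A (1 + z) ^ 2\<close>.\<close>
    proof (rule sum.reindex_bij_witness[of _ "\<lambda>t. (1 - t) / 2" "\<lambda>y. 1 - 2 * y"])
      fix y :: 'a
      have "1 - (1 - 2 * y) ^ 2 = 4 * (y * (1 - y))"
        by (simp add: power2_eq_square algebra_simps)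
      then have b: "(1 - (1 - 2 * y) ^ 2) / 4 = y * (1 - y)" using four by simp
      have "1 + 2 * z * (1 - 2 * y) + z ^ 2 = (1 + z) ^ 2 - 4 * z * y"
        by (simp add: power2_eq_square algebra_simps)
      also have "\<dots> = (1 + z) ^ 2 * (1 - 4 * z / (1 + z) ^ 2 * y)"
        using z1 by (simp add: right_diff_distrib)
      finally have "C (1 + 2 * z * (1 - 2 * y) + z ^ 2)
          = C (1 + z) ^ 2 * C (1 - 4 * z / (1 + z) ^ 2 * y)"
        by (simp only: mchar_mult[OF C] mchar_power[OF C])
      moreover have "A (1 + z) ^ 2 * C (1 + z) ^ 2 = 1"
        using AC[OF z1] by (metis power_mult_distrib one_power2)
      ultimately have "A (1 + z) ^ 2 * C (1 + 2 * z * (1 - 2 * y) + z ^ 2)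
          = C (1 - 4 * z / (1 + z) ^ 2 * y)"
        by (metis mult.assoc mult_1)
      then show "A (1 + z) ^ 2 * (B ((1 - (1 - 2 * y) ^ 2) / 4) * C (1 + 2 * z * (1 - 2 * y) + z ^ 2))
          = B y * B (1 - y) * C (1 - 4 * z / (1 + z) ^ 2 * y)"
        unfolding b mchar_mult[OF B] by (metis mult.left_commute)
    qed (use two in \<open>auto simp: diff_divide_distrib\<close>)
    then have "P21 A B (cpow B 2) (4 * z / (1 + z) ^ 2) = A (1 + z) ^ 2 * T"
      by (simp add: T_def sum_distrib_left)
    \<comment> \<open>Each product equals the same double sum of \<open>quad_sum\<close>; dividing
      by both Jacobi sums then gives the theorem.\<close>
    moreover have "P21 A E (cmul B quad_char) (z ^ 2) * jacobi B B = jacobi E F * T"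
      using period_quad_sum[OF two B hB C, of "z ^ 2"]
        gegenbauer_quad_sum[OF two B C hB2A[folded C_def] False z2]
      by (simp add: P2 jacobi_def[of E F] T_def Ex Fx)
    ultimately show ?thesis
      unfolding E_def[symmetric] lhs rhs using J1 J2 by (simp add: cpow_def field_simps)
  qed
qed

end
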